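(* Let $n\ge 1$ and let $A\in M_n(\mathbb{C})$. Define $f:[1,\infty]\to[0,\infty)$ by $f(p)=\|A\|_{p,p}$. Then: (1) $f$ is continuous on $[1,\infty]$. (2) There exists $p_0\in[1,\infty]$ such that $f$ is decreasing on $[1,p_0]$ and increasing on $[p_0,\infty]$. Moreover, if $p<p_0$ and $f(p)>f(p_0)$, then $f(p)>f(q)$ for every $q\in(p,p_0)$; and if $p>p_0$ and $f(p)>f(p_0)$, then $f(p)>f(q)$ for every $q\in(p_0,p)$. (3) Let $1\le p<q_0<r\le\infty$. If $$f(q_0)^{1/p-1/r}=f(p)^{1/q_0-1/r}\,f(r)^{1/p-1/q_0},$$ then $$f(q)^{1/p-1/r}=f(p)^{1/q-1/r}\,f(r)^{1/p-1/q}$$ for every $q\in[p,r]$. In particular, $f(p)=f(q_0)=f(r)$ implies $f(p)=f(q)$ for every $q\in[p,r]$.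
   Context: For $\xi=(x_1,\dots,x_n)\in\mathbb{C}^n$, $\|\xi\|_p=(\sum_{i=1}^n|x_i|^p)^{1/p}$ for $1\le p<\infty$ and $\|\xi\|_\infty=\max_i|x_i|$. For $A\in M_n(\mathbb{C})$ (complex $n\times n$ matrices), $\|A\|_{p,p}=\sup\{\|A\xi\|_p:\xi\in\mathbb{C}^n,\ \|\xi\|_p=1\}$. Conventions: $1/\infty=0$; $[1,\infty]$ carries its usual topology (so continuity at $\infty$ means $\lim_{p\to\infty}f(p)=f(\infty)$); "decreasing" and "increasing" are meant in the non-strict sense; $0^0=1$. *)

theory Defs
  imports "HOL-Analysis.Analysis"
begin

text \<open>
  Exponents range over the extended reals in \<open>{1..\<infinity>}\<close>, whose order topology is the usual one.
  In \<^typ>\<open>ereal\<close> we have \<open>1 / \<infinity> = 0\<close>.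
\<close>

definition lp_norm :: "ereal \<Rightarrow> complex ^ 'n \<Rightarrow> real" where
  "lp_norm p x =
     (if p = \<infinity> then Max (range (\<lambda>i. cmod (x $ i)))
      else (\<Sum>i\<in>UNIV. cmod (x $ i) powr real_of_ereal p) powr (1 / real_of_ereal p))"

definition lp_op_norm :: "complex ^ 'n ^ 'n \<Rightarrow> ereal \<Rightarrow> real" where
  "lp_op_norm A p = Sup {lp_norm p (A *v x) |x. lp_norm p x = 1}"

definition recip :: "ereal \<Rightarrow> real" where
  "recip p = real_of_ereal (1 / p)"

text \<open>The library has \<open>0 powr 0 = 0\<close>; here \<open>0\<^sup>0 = 1\<close>.\<close>

definition rpow :: "real \<Rightarrow> real \<Rightarrow> real" where
  "rpow x a = (if a = 0 then 1 else x powr a)"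

lemma recip_simps [simp]: "recip \<infinity> = 0" "recip (ereal p) = 1 / p"
  by (simp_all add: recip_def one_ereal_def divide_ereal_def inverse_eq_divide)

text \<open>
  The supremum in \<^const>\<open>lp_op_norm\<close> is taken in the conditionally complete order of the reals;
  it is genuine for \<open>1 \<le> p\<close>, since the set is nonempty and bounded above.
\<close>

lemma lp_norm_axis_1:
  assumes "1 \<le> p"
  shows "lp_norm p (axis k 1 :: complex ^ 'n) = 1"
proof (cases "p = \<infinity>")
  case True
  have "Max (range (\<lambda>i. cmod ((axis k 1 :: complex ^ 'n) $ i))) = 1"
    by (rule Max_eqI) (auto simp: axis_def image_iff)
  with True show ?thesis by (simp add: lp_norm_def)
next
  case False
  have "(\<Sum>i\<in>UNIV. cmod ((axis k 1 :: complex ^ 'n) $ i) powr real_of_ereal p)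
      = (\<Sum>i\<in>UNIV. if i = k then 1 else 0)"
    by (rule sum.cong) (auto simp: axis_def)
  with False show ?thesis by (simp add: lp_norm_def)
qed

lemma cmod_nth_le_lp_norm:
  assumes "1 \<le> p"
  shows "cmod (x $ i) \<le> lp_norm p x"
proof (cases "p = \<infinity>")
  case True
  then show ?thesis by (simp add: lp_norm_def)
next
  case False
  then obtain s where s: "p = ereal s" "1 \<le> s"
    using assms by (cases p) auto
  have "cmod (x $ i) = (cmod (x $ i) powr s) powr (1 / s)"
    using s by (simp add: powr_powr)
  also have "\<dots> \<le> (\<Sum>i\<in>UNIV. cmod (x $ i) powr s) powr (1 / s)"
    using s by (intro powr_mono2 member_le_sum) auto
  finally show ?thesis using s by (simp add: lp_norm_def)
qed

lemma lp_op_norm_set_nonempty: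
  fixes A :: "complex ^ 'n ^ 'n"
  assumes "1 \<le> p"
  shows "{lp_norm p (A *v x) |x. lp_norm p x = 1} \<noteq> {}"
  using lp_norm_axis_1[OF assms] by blast

lemma lp_op_norm_set_bdd_above:
  fixes A :: "complex ^ 'n ^ 'n"
  assumes p: "1 \<le> p"
  shows "bdd_above {lp_norm p (A *v x) |x. lp_norm p x = 1}"
proof -
  define C where "C = (\<Sum>i\<in>UNIV. \<Sum>j\<in>UNIV. cmod (A $ i $ j))"
  have C: "cmod ((A *v x) $ i) \<le> C" if "lp_norm p x = 1" for x i
  proof -
    have "cmod ((A *v x) $ i) \<le> (\<Sum>j\<in>UNIV. cmod (A $ i $ j) * cmod (x $ j))"
      unfolding matrix_vector_mult_def
      by (simp add: norm_mult sum_norm_le)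
    also have "\<dots> \<le> (\<Sum>j\<in>UNIV. cmod (A $ i $ j))"
      using cmod_nth_le_lp_norm[OF p, of x] that
      by (intro sum_mono) (simp add: mult_left_le)
    also have "\<dots> \<le> C"
      unfolding C_def by (intro member_le_sum[where f = "\<lambda>i. \<Sum>j\<in>UNIV. cmod (A $ i $ j)"])
        (auto intro: sum_nonneg)
    finally show ?thesis .
  qed
  have "C \<ge> 0" unfolding C_def by (intro sum_nonneg) auto
  show ?thesis
  proof (cases "p = \<infinity>")
    case True
    show ?thesis
      by (rule bdd_aboveI[where M = C]) (use C in \<open>auto simp: lp_norm_def True\<close>)
  next
    case False
    then obtain s where s: "p = ereal s" "1 \<le> s"
      using p by (cases p) auto
    have "lp_norm p (A *v x) \<le> (\<Sum>i\<in>(UNIV :: 'n set). C powr s) powr (1 / s)"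
      if "lp_norm p x = 1" for x
      using s C[OF that] by (auto simp: lp_norm_def simp del: sum_constant
        intro!: powr_mono2 sum_mono sum_nonneg)
    then show ?thesis by (intro bdd_aboveI) blast
  qed
qed

end

theory Submission
  imports Defs "HOL-Complex_Analysis.Conformal_Mappings"
begin

text \<open>
  For \<open>A = 0\<close> the operator norm vanishes identically. Otherwise everything follows from a single
  fact: for \<open>A \<noteq> 0\<close>, the function
  \<open>h t = ln \<parallel>A\<parallel>\<close>, with the operator norm taken for the exponent \<open>1/t\<close>, is continuous and convex
  on \<open>{0..1}\<close>. Since \<open>p \<mapsto> 1/p\<close> is a continuous decreasing bijection of \<open>[1,\<infinity>]\<close> onto \<open>[0,1]\<close>,
  continuity of \<open>h\<close> is continuity of the operator norm in the exponent; a minimum point of \<open>h\<close>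
  gives the turning point \<open>p0\<close>; and the equality in the third part says, after taking logarithms,
  that the graph of \<open>h\<close> meets a chord in an interior point, which for a convex function forces the
  graph to coincide with the chord (\<open>convex_on_affine_if_touching\<close>).

  Continuity is elementary. Writing \<open>\<parallel>x\<parallel>(t)\<close> for the norm with exponent \<open>1/t\<close>, one has
  \<open>\<parallel>x\<parallel>(s) \<le> \<parallel>x\<parallel>(t) \<le> n powr (t - s) * \<parallel>x\<parallel>(s)\<close> for \<open>s \<le> t\<close>, the second inequality by Hoelder, so
  \<open>h\<close> is Lipschitz with constant \<open>ln n\<close>, including the end point \<open>t = 0\<close>
  (\<open>log_op_norm_Lipschitz\<close>).

  Convexity is the Riesz--Thorin theorem. By continuity it is enough to prove it on the open interval
  (\<open>convex_on_closure\<close>), where all exponents, and their conjugates, are finite and larger than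
  \<open>1\<close>. There one moves \<open>x\<close> and a vector dual to \<open>A x\<close> along analytic families indexed by the strip
  \<open>0 \<le> Re z \<le> 1\<close> and applies Hadamard's three lines theorem to the resulting bilinear expression
  (\<open>Riesz_Thorin_interior\<close>). The three lines theorem comes from the maximum modulus principle on
  large rectangles.
\<close>

section \<open>Convex functions of a real variable\<close>

text \<open>
  Limits of convex combinations are convex combinations of the limits, and the inequality is not strict.
\<close>

lemma convex_on_closure:
  fixes f :: "'a::real_normed_vector \<Rightarrow> real"
  assumes f: "convex_on S f" and cont: "continuous_on (closure S) f"
  shows "convex_on (closure S) f"
proof (rule convex_onI)
  show "convex (closure S)"
    using f by (intro convex_closure convex_on_imp_convex)
  fix t :: real and x y assume t: "0 < t" "t < 1" and "x \<in> closure S" "y \<in> closure S"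
  then obtain u v where u: "\<And>n. u n \<in> S" "u \<longlonglongrightarrow> x" and v: "\<And>n. v n \<in> S" "v \<longlonglongrightarrow> y"
    by (auto simp: closure_sequential)
  have lim: "(\<lambda>n. f (w n)) \<longlonglongrightarrow> f l" if "\<And>n. w n \<in> S" "w \<longlonglongrightarrow> l" for w l
  proof (rule continuous_on_tendsto_compose[OF cont that(2)])
    show "l \<in> closure S" using that by (auto simp: closure_sequential)
    show "\<forall>\<^sub>F n in sequentially. w n \<in> closure S"
      using that(1) closure_subset by (intro always_eventually) blast
  qed
  have conv: "(1 - t) *\<^sub>R u n + t *\<^sub>R v n \<in> S" for n
    using convexD[OF convex_on_imp_convex[OF f], of "u n" "v n" "1 - t" t] u v t by simp
  show "f ((1 - t) *\<^sub>R x + t *\<^sub>R y) \<le> (1 - t) * f x + t * f y"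
  proof (rule LIMSEQ_le)
    show "(\<lambda>n. f ((1 - t) *\<^sub>R u n + t *\<^sub>R v n)) \<longlonglongrightarrow> f ((1 - t) *\<^sub>R x + t *\<^sub>R y)"
      by (intro lim conv tendsto_intros u v)
    show "(\<lambda>n. (1 - t) * f (u n) + t * f (v n)) \<longlonglongrightarrow> (1 - t) * f x + t * f y"
      by (intro tendsto_intros lim u v)
    show "\<exists>N. \<forall>n\<ge>N. f ((1 - t) *\<^sub>R u n + t *\<^sub>R v n) \<le> (1 - t) * f (u n) + t * f (v n)"
      using convex_onD[OF f] u v t by auto
  qed
qed

text \<open>
  Convexity with denominators cleared, so that the weights need not be normalised later.
\<close>

lemma convex_on_three_points:
  fixes f :: "real \<Rightarrow> real"
  assumes f: "convex_on S f" and "a \<in> S" "b \<in> S" "a \<le> x" "x \<le> b"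
  shows "(b - a) * f x \<le> (b - x) * f a + (x - a) * f b"
proof (cases "a = b")
  case False
  then have ab: "a < b" using assms by auto
  define t where "t = (x - a) / (b - a)"
  have t: "0 \<le> t" "t \<le> 1" "(b - a) * t = x - a"
    using ab assms by (auto simp: t_def field_simps)
  have "x = (1 - t) *\<^sub>R a + t *\<^sub>R b"
    using t(3) by (simp add: algebra_simps)
  then have "f x \<le> (1 - t) * f a + t * f b"
    using convex_onD[OF f t(1,2), of a b] assms by simp
  then have "(b - a) * f x \<le> (b - a) * ((1 - t) * f a + t * f b)"
    using ab by (intro mult_left_mono) auto
  also have "\<dots> = ((b - a) - (b - a) * t) * f a + ((b - a) * t) * f b"
    by (simp add: algebra_simps)
  finally show ?thesis using t(3) by simp
qed (use assms in auto)

text \<open>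
  If \<open>f\<close> were strictly below the chord at some \<open>x\<close>, say \<open>x < c\<close>, then the chord from \<open>x\<close> to \<open>b\<close> would
  pass strictly below the chord from \<open>a\<close> to \<open>b\<close> at \<open>c\<close>, and so would \<open>f c\<close>.
\<close>

lemma convex_on_affine_if_touching:
  fixes f :: "real \<Rightarrow> real"
  assumes f: "convex_on S f" and S: "a \<in> S" "b \<in> S" and c: "a < c" "c < b"
    and eq: "(b - a) * f c = (b - c) * f a + (c - a) * f b"
    and x: "a \<le> x" "x \<le> b"
  shows "(b - a) * f x = (b - x) * f a + (x - a) * f b"
proof (rule antisym)
  show "(b - a) * f x \<le> (b - x) * f a + (x - a) * f b"
    by (rule convex_on_three_points[OF f S x])
  have xS: "x \<in> S"
    using S x convex_on_imp_convex[OF f] by (meson atLeastAtMost_iff connected_contains_Icc convex_connected subsetD)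
  show "(b - x) * f a + (x - a) * f b \<le> (b - a) * f x"
  proof (cases "x < c")
    case True
    have "(b - x) * f c \<le> (b - c) * f x + (c - x) * f b"
      by (rule convex_on_three_points[OF f xS S(2)]) (use True c in auto)
    then have "(b - a) * ((b - x) * f c) \<le> (b - a) * ((b - c) * f x + (c - x) * f b)"
      using c by (intro mult_left_mono) auto
    moreover have "(b - a) * ((b - x) * f c) = (b - x) * ((b - c) * f a + (c - a) * f b)"
      unfolding eq[symmetric] by simp
    ultimately have "(b - c) * ((b - x) * f a + (x - a) * f b) \<le> (b - c) * ((b - a) * f x)"
      by (simp add: algebra_simps)
    then show ?thesis using c by simp
  next
    case False
    have "(x - a) * f c \<le> (x - c) * f a + (c - a) * f x"
      by (rule convex_on_three_points[OF f S(1) xS]) (use False c in auto)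
    then have "(b - a) * ((x - a) * f c) \<le> (b - a) * ((x - c) * f a + (c - a) * f x)"
      using c by (intro mult_left_mono) auto
    moreover have "(b - a) * ((x - a) * f c) = (x - a) * ((b - c) * f a + (c - a) * f b)"
      unfolding eq[symmetric] by simp
    ultimately have "(c - a) * ((b - x) * f a + (x - a) * f b) \<le> (c - a) * ((b - a) * f x)"
      by (simp add: algebra_simps)
    then show ?thesis using c by simp
  qed
qed

text \<open>
  Strictly inside an interval \<open>f\<close> is at most an average of its two end values in which both weights
  are positive, and such an average is at most the larger end value, and
  strictly below it if the two differ.
\<close>

lemma convex_on_between:
  fixes f :: "real \<Rightarrow> real"
  assumes f: "convex_on S f" and m: "m \<in> S" "y \<in> S"
    and x: "m < x \<and> x < y \<or> y < x \<and> x < m"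
  shows "f m \<le> f y \<Longrightarrow> f x \<le> f y" and "f m < f y \<Longrightarrow> f x < f y"
proof -
  have avg: "\<bar>y - m\<bar> * f x \<le> \<bar>y - x\<bar> * f m + \<bar>x - m\<bar> * f y"
    using x convex_on_three_points[OF f m(1,2), of x] convex_on_three_points[OF f m(2,1), of x]
    by (auto simp: abs_if)
  have split: "\<bar>y - x\<bar> * f y + \<bar>x - m\<bar> * f y = \<bar>y - m\<bar> * f y"
    using x by (auto simp: abs_if algebra_simps)
  have pos: "0 < \<bar>y - x\<bar>" "0 < \<bar>y - m\<bar>" using x by auto
  show "f x \<le> f y" if "f m \<le> f y"
  proof -
    have "\<bar>y - x\<bar> * f m \<le> \<bar>y - x\<bar> * f y" using that by (intro mult_left_mono) auto
    then have "\<bar>y - m\<bar> * f x \<le> \<bar>y - m\<bar> * f y" using avg split by linarith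
    then show ?thesis using pos by simp
  qed
  show "f x < f y" if "f m < f y"
  proof -
    have "\<bar>y - x\<bar> * f m < \<bar>y - x\<bar> * f y" using that pos by simp
    then have "\<bar>y - m\<bar> * f x < \<bar>y - m\<bar> * f y" using avg split by linarith
    then show ?thesis using pos by simp
  qed
qed

section \<open>Hadamard's three lines theorem\<close>

text \<open>
  A bounded function on the strip may fail to attain its supremum. The factor
  \<open>exp (e * (z\<^sup>2 - 1))\<close> has modulus at most \<open>1\<close> on the strip and decays as \<open>\<bar>Im z\<bar>\<close> grows, so on a
  sufficiently tall rectangle the damped function is bounded by \<open>1\<close> on the whole boundary; then
  \<open>e\<close> tends to \<open>0\<close>.
\<close>

lemma three_lines_unit:
  assumes hol: "F holomorphic_on {z. 0 < Re z \<and> Re z < 1}"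
    and cont: "continuous_on {z. 0 \<le> Re z \<and> Re z \<le> 1} F"
    and B: "\<And>z. 0 \<le> Re z \<Longrightarrow> Re z \<le> 1 \<Longrightarrow> cmod (F z) \<le> B"
    and le0: "\<And>z. Re z = 0 \<Longrightarrow> cmod (F z) \<le> 1"
    and le1: "\<And>z. Re z = 1 \<Longrightarrow> cmod (F z) \<le> 1"
    and z: "0 \<le> Re z" "Re z \<le> 1"
  shows "cmod (F z) \<le> 1"
proof -
  have damped: "cmod (F z) * exp (e * ((Re z)\<^sup>2 - (Im z)\<^sup>2 - 1)) \<le> 1" if e: "0 < e" for e :: real
  proof -
    define E where "E w = exp (complex_of_real e * (w\<^sup>2 - 1))" for w
    have E: "cmod (E w) = exp (e * ((Re w)\<^sup>2 - (Im w)\<^sup>2 - 1))" for w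
      by (simp add: E_def power2_eq_square)
    have E_le: "cmod (E w) \<le> exp (- (e * (Im w)\<^sup>2))" if "0 \<le> Re w" "Re w \<le> 1" for w
    proof -
      have "(Re w)\<^sup>2 \<le> 1" using that by (simp add: power_le_one)
      then have "e * ((Re w)\<^sup>2 - (Im w)\<^sup>2 - 1) \<le> e * (- (Im w)\<^sup>2)"
        using e by (intro mult_left_mono) auto
      then show ?thesis by (simp add: E)
    qed
    \<comment> \<open>At a height of at least \<open>1\<close> and \<open>B / e\<close> the damping outweighs the bound \<open>B\<close>.\<close>
    define R where "R = max (\<bar>Im z\<bar> + 1) (B / e)"
    have R: "\<bar>Im z\<bar> \<le> R" "1 \<le> R"
      using e by (auto simp: R_def)
    have "B / e \<le> R" by (simp add: R_def)
    then have "B \<le> e * R" using e by (simp add: field_simps)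
    have "R * 1 \<le> R * R" using R by (intro mult_left_mono) auto
    then have "e * R \<le> e * R\<^sup>2"
      using e by (simp add: power2_eq_square)
    then have expR: "B \<le> exp (e * R\<^sup>2)"
      using \<open>B \<le> e * R\<close> exp_ge_add_one_self[of "e * R\<^sup>2"] by linarith
    define S where "S = cbox (Complex 0 (-R)) (Complex 1 R)"
    have in_S: "w \<in> S \<longleftrightarrow> 0 \<le> Re w \<and> Re w \<le> 1 \<and> -R \<le> Im w \<and> Im w \<le> R" for w
      by (auto simp: S_def in_cbox_complex_iff)
    have int_S: "w \<in> interior S \<longleftrightarrow> 0 < Re w \<and> Re w < 1 \<and> -R < Im w \<and> Im w < R" for w
      by (auto simp: S_def in_box_complex_iff)
    have "cmod (F z * E z) \<le> 1"
    proof (rule maximum_modulus_frontier[of "\<lambda>w. F w * E w" S])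
      show "(\<lambda>w. F w * E w) holomorphic_on interior S"
        unfolding E_def
        by (intro holomorphic_intros holomorphic_on_subset[OF hol]) (auto simp: int_S)
      have "closure S = S" by (simp add: S_def)
      then show "continuous_on (closure S) (\<lambda>w. F w * E w)"
        unfolding E_def
        by (intro continuous_intros continuous_on_subset[OF cont]) (auto simp: in_S)
      show "bounded S" by (simp add: S_def)
      show "z \<in> S" using z R by (auto simp: in_S)
      fix w assume "w \<in> frontier S"
      then have "w \<in> S" "w \<notin> interior S"
        by (auto simp: frontier_def S_def)
      then have w: "0 \<le> Re w" "Re w \<le> 1" and edge: "Re w = 0 \<or> Re w = 1 \<or> \<bar>Im w\<bar> = R"
        by (auto simp: in_S int_S)
      have "cmod (F w) * cmod (E w) \<le> 1"
      proof (cases "\<bar>Im w\<bar> = R")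
        case True
        then have "(Im w)\<^sup>2 = R\<^sup>2" by (metis power2_abs)
        then have "cmod (F w) * cmod (E w) \<le> exp (e * R\<^sup>2) * exp (- (e * R\<^sup>2))"
          using E_le[OF w] B[OF w] expR by (intro mult_mono) auto
        also have "\<dots> = 1" by (simp add: exp_minus)
        finally show ?thesis .
      next
        case False
        then have "cmod (F w) \<le> 1" using edge le0 le1 by auto
        moreover have "cmod (E w) \<le> 1"
          using E_le[OF w] e by (smt (verit) exp_le_one_iff mult_nonneg_nonneg zero_le_power2)
        ultimately show ?thesis by (simp add: mult_le_one)
      qed
      then show "cmod (F w * E w) \<le> 1" by (simp add: norm_mult)
    qed
    then show ?thesis by (simp add: norm_mult E)
  qed
  have "((\<lambda>e. cmod (F z) * exp (e * ((Re z)\<^sup>2 - (Im z)\<^sup>2 - 1))) \<longlongrightarrow>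
           cmod (F z) * exp (0 * ((Re z)\<^sup>2 - (Im z)\<^sup>2 - 1))) (at_right 0)"
    by (intro tendsto_intros)
  moreover have "eventually (\<lambda>e. cmod (F z) * exp (e * ((Re z)\<^sup>2 - (Im z)\<^sup>2 - 1)) \<le> 1) (at_right 0)"
    using damped by (auto simp: eventually_at_filter)
  ultimately have "cmod (F z) * exp (0 * ((Re z)\<^sup>2 - (Im z)\<^sup>2 - 1)) \<le> 1"
    by (rule tendsto_upperbound) simp
  then show ?thesis by simp
qed

text \<open>
  Multiplication by \<open>M0 powr (z - 1) * M1 powr (- z)\<close>, whose modulus depends only on \<open>Re z\<close>,
  normalises both boundary bounds to \<open>1\<close>.
\<close>

theorem Hadamard_three_lines:
  assumes hol: "F holomorphic_on {z. 0 < Re z \<and> Re z < 1}"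
    and cont: "continuous_on {z. 0 \<le> Re z \<and> Re z \<le> 1} F"
    and B: "\<And>z. 0 \<le> Re z \<Longrightarrow> Re z \<le> 1 \<Longrightarrow> cmod (F z) \<le> B"
    and M: "0 < M0" "0 < M1"
    and le0: "\<And>z. Re z = 0 \<Longrightarrow> cmod (F z) \<le> M0"
    and le1: "\<And>z. Re z = 1 \<Longrightarrow> cmod (F z) \<le> M1"
    and z: "0 \<le> Re z" "Re z \<le> 1"
  shows "cmod (F z) \<le> M0 powr (1 - Re z) * M1 powr Re z"
proof -
  define E where "E w = exp (- ((1 - w) * complex_of_real (ln M0) + w * complex_of_real (ln M1)))" for w
  have E: "cmod (E w) = exp (- ((1 - Re w) * ln M0 + Re w * ln M1))" for w
    by (simp add: E_def)
  have "cmod (F z * E z) \<le> 1"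
  proof (rule three_lines_unit[where F = "\<lambda>w. F w * E w" and B = "B * exp (\<bar>ln M0\<bar> + \<bar>ln M1\<bar>)"])
    show "(\<lambda>w. F w * E w) holomorphic_on {z. 0 < Re z \<and> Re z < 1}"
      unfolding E_def by (intro holomorphic_intros hol)
    show "continuous_on {z. 0 \<le> Re z \<and> Re z \<le> 1} (\<lambda>w. F w * E w)"
      unfolding E_def by (intro continuous_intros cont)
    show "cmod (F w * E w) \<le> 1" if "Re w = 0" for w
      using le0[OF that] M that by (simp add: norm_mult E exp_minus field_simps)
    show "cmod (F w * E w) \<le> 1" if "Re w = 1" for w
      using le1[OF that] M that by (simp add: norm_mult E exp_minus field_simps)
    show "cmod (F w * E w) \<le> B * exp (\<bar>ln M0\<bar> + \<bar>ln M1\<bar>)" if w: "0 \<le> Re w" "Re w \<le> 1" for w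
    proof -
      have "\<bar>(1 - Re w) * ln M0\<bar> \<le> \<bar>ln M0\<bar>" "\<bar>Re w * ln M1\<bar> \<le> \<bar>ln M1\<bar>"
        using w by (auto simp: abs_mult intro!: mult_left_le_one_le)
      then have "cmod (E w) \<le> exp (\<bar>ln M0\<bar> + \<bar>ln M1\<bar>)"
        by (simp add: E)
      moreover have "0 \<le> B" using B[OF w] norm_ge_zero order_trans by blast
      ultimately show ?thesis using B[OF w] by (auto simp: norm_mult intro!: mult_mono)
    qed
  qed (use z in auto)
  then have "cmod (F z) / exp ((1 - Re z) * ln M0 + Re z * ln M1) \<le> 1"
    by (simp add: norm_mult E divide_inverse flip: exp_minus)
  then have "cmod (F z) \<le> exp ((1 - Re z) * ln M0 + Re z * ln M1)"
    by simp
  also have "\<dots> = M0 powr (1 - Re z) * M1 powr Re z"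
    using M by (simp add: powr_def exp_add)
  finally show ?thesis .
qed

section \<open>Vector norms and operator norms\<close>

lemma lp_norm_nonneg: "1 \<le> p \<Longrightarrow> 0 \<le> lp_norm p x"
  using cmod_nth_le_lp_norm[of p x] norm_ge_zero order_trans by blast

lemma lp_norm_pos: "1 \<le> p \<Longrightarrow> x \<noteq> 0 \<Longrightarrow> 0 < lp_norm p x"
  using cmod_nth_le_lp_norm[of p x]
  by (metis norm_le_zero_iff not_le vec_eq_iff zero_index order_trans)

lemma lp_norm_zero [simp]: "lp_norm p 0 = 0"
  by (simp add: lp_norm_def)

lemma lp_norm_scale:
  assumes "1 \<le> p"
  shows "lp_norm p (c *s x) = cmod c * lp_norm p x"
proof (cases "p = \<infinity>")
  case True
  have "Max (range (\<lambda>i. cmod ((c *s x) $ i))) = Max ((*) (cmod c) ` range (\<lambda>i. cmod (x $ i)))"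
    by (simp add: norm_mult image_image)
  also have "\<dots> = cmod c * Max (range (\<lambda>i. cmod (x $ i)))"
    by (rule mono_Max_commute[symmetric]) (auto intro!: monoI mult_left_mono)
  finally show ?thesis using True by (simp add: lp_norm_def)
next
  case False
  define s where "s = real_of_ereal p"
  have s: "s \<noteq> 0" using False assms by (cases p) (auto simp: s_def)
  have "(\<Sum>i\<in>UNIV. cmod ((c *s x) $ i) powr s) powr (1 / s)
      = (cmod c powr s * (\<Sum>i\<in>UNIV. cmod (x $ i) powr s)) powr (1 / s)"
    by (simp add: norm_mult powr_mult sum_distrib_left)
  also have "\<dots> = cmod c * (\<Sum>i\<in>UNIV. cmod (x $ i) powr s) powr (1 / s)"
    using s by (simp add: powr_mult powr_powr)
  finally show ?thesis
    using False by (simp add: lp_norm_def s_def)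
qed

lemma lp_norm_matrix_vector_le:
  assumes "1 \<le> p"
  shows "lp_norm p (A *v x) \<le> lp_op_norm A p * lp_norm p x"
proof (cases "x = 0")
  case False
  define c where "c = lp_norm p x"
  have c: "c > 0" using lp_norm_pos[OF assms False] by (simp add: c_def)
  define y where "y = complex_of_real (1 / c) *s x"
  have "lp_norm p y = 1"
    using c by (simp add: y_def lp_norm_scale[OF assms] norm_divide c_def[symmetric])
  then have "lp_norm p (A *v y) \<le> lp_op_norm A p"
    unfolding lp_op_norm_def by (intro cSup_upper lp_op_norm_set_bdd_above assms) auto
  moreover have "lp_norm p (A *v y) = lp_norm p (A *v x) / c"
    using c by (simp add: y_def vector_scalar_commute lp_norm_scale[OF assms] norm_divide)
  ultimately show ?thesis using c by (simp add: c_def[symmetric] field_simps)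
qed simp

lemma lp_op_norm_le:
  assumes "1 \<le> p" and "\<And>x. lp_norm p (A *v x) \<le> K * lp_norm p x"
  shows "lp_op_norm A p \<le> K"
  unfolding lp_op_norm_def
  using assms(2) by (intro cSup_least lp_op_norm_set_nonempty assms(1)) (auto, metis mult.right_neutral)

lemma lp_op_norm_pos:
  assumes "1 \<le> p" "A \<noteq> 0"
  shows "0 < lp_op_norm A p"
proof -
  obtain x where x: "A *v x \<noteq> 0"
    using assms(2) matrix_eq[of A 0] by auto
  then have "x \<noteq> 0" by auto
  then show ?thesis
    using lp_norm_pos[OF assms(1) x] lp_norm_pos[OF assms(1), of x] lp_norm_matrix_vector_le[OF assms(1), of A x]
    by (smt (verit) mult_nonpos_nonneg)
qed

lemma lp_op_norm_zero:
  assumes "1 \<le> p"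
  shows "lp_op_norm (0 :: complex ^ 'n ^ 'n) p = 0"
proof -
  have "{lp_norm p ((0 :: complex ^ 'n ^ 'n) *v x) |x. lp_norm p x = 1} = {0}"
    using lp_norm_axis_1[OF assms] by auto
  then show ?thesis by (simp add: lp_op_norm_def)
qed

text \<open>
  The inverse of \<^const>\<open>recip\<close>: the interpolation parameter is the reciprocal of the exponent, and
  \<open>t = 0\<close> stands for the exponent \<open>\<infinity>\<close>.
\<close>

abbreviation exponent :: "real \<Rightarrow> ereal" where
  "exponent t \<equiv> 1 / ereal t"

lemma exponent_zero: "exponent 0 = \<infinity>"
  by (simp add: zero_ereal_def[symmetric] divide_ereal_def)

lemma exponent_pos: "0 < t \<Longrightarrow> exponent t = ereal (1 / t)"
  by (simp add: one_ereal_def)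

lemma exponent_ge_1: "0 \<le> t \<Longrightarrow> t \<le> 1 \<Longrightarrow> 1 \<le> exponent t"
  by (cases "t = 0") (auto simp: exponent_zero exponent_pos)

lemma lp_norm_exponent:
  "0 < t \<Longrightarrow> lp_norm (exponent t) x = (\<Sum>i\<in>UNIV. cmod (x $ i) powr (1 / t)) powr t"
  by (simp add: exponent_pos lp_norm_def)

lemma recip_exponent: "0 \<le> t \<Longrightarrow> recip (exponent t) = t"
  by (cases "t = 0") (auto simp: exponent_zero exponent_pos)

lemma recip_bounds: "1 \<le> p \<Longrightarrow> 0 \<le> recip p \<and> recip p \<le> 1"
  by (cases p) auto

lemma exponent_recip: "1 \<le> p \<Longrightarrow> exponent (recip p) = p"
  by (cases p) (auto simp: exponent_zero exponent_pos)

lemma recip_less: "1 \<le> p \<Longrightarrow> p < q \<Longrightarrow> recip q < recip p"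
  by (cases p; cases q) (auto simp: field_simps)

lemma recip_le: "1 \<le> p \<Longrightarrow> p \<le> q \<Longrightarrow> recip q \<le> recip p"
  using recip_less[of p q] by (cases "p = q") (auto simp: less_le)

lemma continuous_on_recip: "continuous_on {1..\<infinity>} recip"
proof -
  have "continuous_on {1..\<infinity>} (\<lambda>p::ereal. inverse p)"
    by (rule continuous_on_subset[OF continuous_on_inverse_ereal]) (auto intro: order_trans[of 0 1])
  moreover have "inverse p \<noteq> \<infinity> \<and> inverse p \<noteq> -\<infinity>" if "1 \<le> p" for p :: ereal
    using that by (cases p) auto
  ultimately have "continuous_on {1..\<infinity>} (\<lambda>p::ereal. real_of_ereal (inverse p))"
    by (intro continuous_on_compose2[OF continuous_on_real]) auto
  then show ?thesis by (simp add: recip_def[abs_def] divide_ereal_def)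
qed

section \<open>Comparison of the norms for different exponents\<close>

text \<open>
  Hoelder's inequality with the powers moved to the other side: after normalising both sums to \<open>1\<close>
  it is the sum of the weighted arithmetic-geometric mean inequalities of the terms. In this form the
  weights \<open>\<alpha>\<close> and \<open>1 - \<alpha>\<close> are themselves the reciprocals of conjugate exponents.
\<close>

lemma Holder_sum:
  fixes a b :: "'i \<Rightarrow> real"
  assumes "finite I" "0 \<le> \<alpha>" "\<alpha> \<le> 1" "\<And>i. i \<in> I \<Longrightarrow> 0 \<le> a i" "\<And>i. i \<in> I \<Longrightarrow> 0 \<le> b i"
  shows "(\<Sum>i\<in>I. a i powr \<alpha> * b i powr (1 - \<alpha>)) \<le> (\<Sum>i\<in>I. a i) powr \<alpha> * (\<Sum>i\<in>I. b i) powr (1 - \<alpha>)"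
proof (cases "(\<Sum>i\<in>I. a i) = 0 \<or> (\<Sum>i\<in>I. b i) = 0")
  case True
  then have "(\<forall>i\<in>I. a i = 0) \<or> (\<forall>i\<in>I. b i = 0)"
    using assms by (simp add: sum_nonneg_eq_0_iff)
  then have "(\<Sum>i\<in>I. a i powr \<alpha> * b i powr (1 - \<alpha>)) = 0"
    by (intro sum.neutral) auto
  then show ?thesis by simp
next
  case False
  define X where "X = (\<Sum>i\<in>I. a i)"
  define Y where "Y = (\<Sum>i\<in>I. b i)"
  have XY: "X > 0" "Y > 0"
    using False assms by (auto simp: X_def Y_def less_le sum_nonneg)
  have "(\<Sum>i\<in>I. (a i / X) powr \<alpha> * (b i / Y) powr (1 - \<alpha>))
     \<le> (\<Sum>i\<in>I. \<alpha> * (a i / X) + (1 - \<alpha>) * (b i / Y))"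
  proof (rule sum_mono)
    fix i assume i: "i \<in> I"
    show "(a i / X) powr \<alpha> * (b i / Y) powr (1 - \<alpha>) \<le> \<alpha> * (a i / X) + (1 - \<alpha>) * (b i / Y)"
    proof (cases "a i = 0 \<or> b i = 0")
      case True
      then show ?thesis using XY assms i by auto
    next
      case False
      then show ?thesis
        using XY assms i by (intro Youngs_inequality_0) (auto simp: less_le)
    qed
  qed
  also have "\<dots> = 1"
    using XY by (simp add: sum.distrib sum_distrib_left[symmetric] sum_divide_distrib[symmetric] X_def[symmetric] Y_def[symmetric])
  finally have "(\<Sum>i\<in>I. a i powr \<alpha> * b i powr (1 - \<alpha>)) / (X powr \<alpha> * Y powr (1 - \<alpha>)) \<le> 1"
    by (simp add: sum_divide_distrib powr_divide)
  then show ?thesis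
    using XY by (simp add: X_def[symmetric] Y_def[symmetric] field_simps)
qed

text \<open>
  Every entry is bounded by the norm \<open>N\<close> for the smaller exponent \<open>1/t\<close>, so replacing that exponent by
  \<open>1/s\<close> costs at most the factor \<open>N powr (1/s - 1/t)\<close> in the sum of powers.
\<close>

lemma lp_norm_antimono:
  assumes "0 \<le> s" "s \<le> t" "t \<le> 1"
  shows "lp_norm (exponent s) x \<le> lp_norm (exponent t) x"
proof -
  define N where "N = lp_norm (exponent t) x"
  have t: "1 \<le> exponent t" using assms by (intro exponent_ge_1) auto
  have le: "cmod (x $ i) \<le> N" for i
    unfolding N_def by (rule cmod_nth_le_lp_norm[OF t])
  have N: "0 \<le> N" using lp_norm_nonneg[OF t] by (simp add: N_def)
  consider "s = 0" | "N = 0" | "0 < s" "0 < N" using assms N by linarith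
  then show ?thesis
  proof cases
    case 1
    then show ?thesis using le by (simp add: exponent_zero lp_norm_def N_def)
  next
    case 2
    then have "x = 0" using lp_norm_pos[OF t, of x] by (auto simp: N_def)
    then show ?thesis by simp
  next
    case 3
    have *: "cmod (x $ i) powr (1 / s) \<le> N powr (1 / s - 1 / t) * cmod (x $ i) powr (1 / t)" for i
    proof -
      have "cmod (x $ i) powr (1 / s) = cmod (x $ i) powr (1 / s - 1 / t) * cmod (x $ i) powr (1 / t)"
        by (simp add: powr_add[symmetric])
      also have "\<dots> \<le> N powr (1 / s - 1 / t) * cmod (x $ i) powr (1 / t)"
        using 3 assms le by (intro mult_right_mono powr_mono2) (auto simp: field_simps)
      finally show ?thesis .
    qed
    have Nt: "N powr (1 / t) = (\<Sum>i\<in>UNIV. cmod (x $ i) powr (1 / t))"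
      using 3 assms by (simp add: N_def lp_norm_exponent powr_powr sum_nonneg)
    have "(\<Sum>i\<in>UNIV. cmod (x $ i) powr (1 / s))
        \<le> N powr (1 / s - 1 / t) * (\<Sum>i\<in>UNIV. cmod (x $ i) powr (1 / t))"
      unfolding sum_distrib_left by (intro sum_mono *)
    also have "\<dots> = N powr (1 / s)"
      unfolding Nt[symmetric] by (simp add: powr_add[symmetric])
    finally have "(\<Sum>i\<in>UNIV. cmod (x $ i) powr (1 / s)) powr s \<le> (N powr (1 / s)) powr s"
      using 3 by (intro powr_mono2) (auto intro: sum_nonneg)
    then show ?thesis
      using 3 by (simp add: lp_norm_exponent powr_powr N_def)
  qed
qed

text \<open>
  For \<open>0 < s\<close> this is Hoelder's inequality against the constant vector \<open>1\<close>; for \<open>s = 0\<close> every entry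
  is bounded by the maximum norm.
\<close>

lemma lp_norm_le_card_powr:
  fixes x :: "complex ^ 'n"
  assumes "0 \<le> s" "s \<le> t" "t \<le> 1"
  shows "lp_norm (exponent t) x \<le> real CARD('n) powr (t - s) * lp_norm (exponent s) x"
proof (cases "t = 0")
  case True
  then show ?thesis using assms by simp
next
  case False
  then have t: "0 < t" using assms by simp
  have "(\<Sum>i\<in>UNIV. cmod (x $ i) powr (1 / t))
      \<le> (lp_norm (exponent s) x * real CARD('n) powr (t - s)) powr (1 / t)"
  proof (cases "s = 0")
    case True
    have "(\<Sum>i\<in>UNIV. cmod (x $ i) powr (1 / t)) \<le> (\<Sum>i\<in>(UNIV::'n set). lp_norm (exponent s) x powr (1 / t))"
      using t assms by (intro sum_mono powr_mono2 cmod_nth_le_lp_norm exponent_ge_1) auto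
    then show ?thesis
      using t True by (simp add: powr_mult powr_powr mult.commute)
  next
    case False
    then have s: "0 < s" using assms by simp
    have "(\<Sum>i\<in>UNIV. cmod (x $ i) powr (1 / t))
        = (\<Sum>i\<in>UNIV. (cmod (x $ i) powr (1 / s)) powr (s / t) * 1 powr (1 - s / t))"
      using s by (simp add: powr_powr)
    also have "\<dots> \<le> (\<Sum>i\<in>UNIV. cmod (x $ i) powr (1 / s)) powr (s / t) * (\<Sum>i\<in>(UNIV::'n set). 1) powr (1 - s / t)"
      using s t assms by (intro Holder_sum) auto
    also have "\<dots> = (lp_norm (exponent s) x * real CARD('n) powr (t - s)) powr (1 / t)"
      using s t by (simp add: lp_norm_exponent powr_mult powr_powr diff_divide_distrib)
    finally show ?thesis .
  qed
  then have "(\<Sum>i\<in>UNIV. cmod (x $ i) powr (1 / t)) powr t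
      \<le> ((lp_norm (exponent s) x * real CARD('n) powr (t - s)) powr (1 / t)) powr t"
    using t by (intro powr_mono2) (auto intro: sum_nonneg)
  then show ?thesis
    using t lp_norm_nonneg[OF exponent_ge_1[of s], of x] assms
    by (simp add: lp_norm_exponent powr_powr abs_mult mult.commute)
qed

section \<open>The logarithm of the operator norm and its continuity\<close>

definition log_op_norm :: "complex ^ 'n ^ 'n \<Rightarrow> real \<Rightarrow> real" where
  "log_op_norm A t = ln (lp_op_norm A (exponent t))"

lemma lp_op_norm_eq_exp:
  assumes "A \<noteq> 0" "0 \<le> t" "t \<le> 1"
  shows "lp_op_norm A (exponent t) = exp (log_op_norm A t)"
  using lp_op_norm_pos[OF exponent_ge_1 assms(1)] assms by (simp add: log_op_norm_def)

lemma log_op_norm_le: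
  assumes "A \<noteq> 0" "0 \<le> t" "t \<le> 1"
    and "\<And>x. lp_norm (exponent t) (A *v x) \<le> exp K * lp_norm (exponent t) x"
  shows "log_op_norm A t \<le> K"
  using lp_op_norm_le[OF exponent_ge_1 assms(4)] assms lp_op_norm_eq_exp[of A t] by simp

lemma lp_norm_le_exp_log_op_norm:
  assumes "A \<noteq> 0" "0 \<le> t" "t \<le> 1"
  shows "lp_norm (exponent t) (A *v x) \<le> exp (log_op_norm A t) * lp_norm (exponent t) x"
  using lp_norm_matrix_vector_le[OF exponent_ge_1, of t A x] assms by (simp add: lp_op_norm_eq_exp)

text \<open>
  Both norms, that of \<open>A x\<close> and that of \<open>x\<close>, are changed between the exponents \<open>1/s\<close> and \<open>1/t\<close>.
  Of the two changes one is free, by monotonicity, and the other costs the factor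
  \<open>n powr (t - s)\<close>.
\<close>

lemma log_op_norm_Lipschitz:
  fixes A :: "complex ^ 'n ^ 'n"
  assumes A: "A \<noteq> 0" and st: "0 \<le> s" "s \<le> t" "t \<le> 1"
  shows "\<bar>log_op_norm A s - log_op_norm A t\<bar> \<le> ln (real CARD('n)) * (t - s)"
proof -
  define K where "K = ln (real CARD('n)) * (t - s)"
  have K: "real CARD('n) powr (t - s) = exp K"
    by (simp add: K_def powr_def mult.commute)
  have cmp: "lp_norm (exponent s) x \<le> lp_norm (exponent t) x"
      "lp_norm (exponent t) x \<le> exp K * lp_norm (exponent s) x" for x :: "complex ^ 'n"
    using lp_norm_antimono[OF st, of x] lp_norm_le_card_powr[OF st, of x] by (simp_all add: K)
  have "log_op_norm A s \<le> log_op_norm A t + K"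
  proof (rule log_op_norm_le)
    fix x
    have "lp_norm (exponent s) (A *v x) \<le> exp (log_op_norm A t) * lp_norm (exponent t) x"
      using cmp(1) lp_norm_le_exp_log_op_norm[OF A, of t x] st by (meson order_trans)
    also have "\<dots> \<le> exp (log_op_norm A t) * (exp K * lp_norm (exponent s) x)"
      by (intro mult_left_mono cmp) auto
    finally show "lp_norm (exponent s) (A *v x) \<le> exp (log_op_norm A t + K) * lp_norm (exponent s) x"
      by (simp add: exp_add mult.assoc)
  qed (use A st in auto)
  moreover have "log_op_norm A t \<le> log_op_norm A s + K"
  proof (rule log_op_norm_le)
    fix x
    have "lp_norm (exponent t) (A *v x) \<le> exp K * lp_norm (exponent s) (A *v x)"
      by (rule cmp)
    also have "\<dots> \<le> exp K * (exp (log_op_norm A s) * lp_norm (exponent s) x)"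
      using A st by (intro mult_left_mono lp_norm_le_exp_log_op_norm) auto
    also have "\<dots> \<le> exp K * (exp (log_op_norm A s) * lp_norm (exponent t) x)"
      by (intro mult_left_mono cmp) auto
    finally show "lp_norm (exponent t) (A *v x) \<le> exp (log_op_norm A s + K) * lp_norm (exponent t) x"
      by (simp add: exp_add mult_ac)
  qed (use A st in auto)
  ultimately show ?thesis by (simp add: K_def)
qed

lemma continuous_on_log_op_norm:
  fixes A :: "complex ^ 'n ^ 'n"
  assumes "A \<noteq> 0"
  shows "continuous_on {0..1} (log_op_norm A)"
proof (rule lipschitz_on_continuous_on)
  show "(ln (real CARD('n)))-lipschitz_on {0..1} (log_op_norm A)"
  proof (rule lipschitz_onI)
    fix s t :: real assume "s \<in> {0..1}" "t \<in> {0..1}"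
    then show "dist (log_op_norm A s) (log_op_norm A t) \<le> ln (real CARD('n)) * dist s t"
      using log_op_norm_Lipschitz[OF assms, of s t] log_op_norm_Lipschitz[OF assms, of t s]
      by (cases "s \<le> t") (auto simp: dist_real_def abs_minus_commute)
  qed (simp add: Suc_le_eq)
qed

section \<open>The Riesz--Thorin theorem\<close>

lemma cnj_sgn_mult_self: "cnj (sgn y) * y = complex_of_real (cmod y)"
proof -
  have "cnj y * y = complex_of_real (cmod y) * complex_of_real (cmod y)"
    by (metis complex_norm_square mult.commute of_real_power power2_eq_square)
  then show ?thesis by (simp add: sgn_eq)
qed

text \<open>
  Let \<open>u\<close> be the intermediate parameter, \<open>b = A x\<close>, \<open>a j = \<bar>x j\<bar> powr (1/u)\<close> and
  \<open>c i = \<bar>b i\<bar> powr (1/u)\<close>, with sums \<open>X\<close> and \<open>C\<close>. With \<open>\<alpha> z = (1 - z) s + z t\<close>, the entries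
  \<open>v j = sgn (x j) * a j powr \<alpha> z\<close> and \<open>w i = cnj (sgn (b i)) * c i powr (1 - \<alpha> z)\<close> are entire in \<open>z\<close>, and
  when \<open>Re (\<alpha> z) = r\<close> the norm of \<open>v\<close> for the exponent \<open>1/r\<close> is \<open>X powr r\<close>, while that of \<open>w\<close> for
  the conjugate exponent \<open>1/(1 - r)\<close> is \<open>C powr (1 - r)\<close>. So Hoelder's inequality bounds the pairing
  \<open>F\<close> of \<open>w\<close> with \<open>A v\<close> on the lines \<open>Re z = 0\<close> and \<open>Re z = 1\<close> through the operator norms for
  \<open>1/s\<close> and \<open>1/t\<close>. At \<open>z = \<theta>\<close> one has \<open>\<alpha> z = u\<close> and \<open>v = x\<close>, and \<open>w\<close> is the vector dual to \<open>b\<close>, so that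
  \<open>F \<theta> = C\<close>. The three lines theorem then bounds \<open>C\<close>; a power of \<open>C\<close> cancels, and what is left is
  the inequality between the norms \<open>C powr u\<close> of \<open>b\<close> and \<open>X powr u\<close> of \<open>x\<close>.
\<close>

lemma Riesz_Thorin_interior:
  fixes A :: "complex ^ 'n ^ 'n"
  assumes A: "A \<noteq> 0" and st: "0 < s" "s < 1" "0 < t" "t < 1" and \<theta>: "0 \<le> \<theta>" "\<theta> \<le> 1"
  shows "log_op_norm A ((1 - \<theta>) * s + \<theta> * t) \<le> (1 - \<theta>) * log_op_norm A s + \<theta> * log_op_norm A t"
proof (rule log_op_norm_le)
  define u where "u = (1 - \<theta>) * s + \<theta> * t"
  have comb: "0 < (1 - \<sigma>) * s + \<sigma> * t \<and> (1 - \<sigma>) * s + \<sigma> * t < 1" if "0 \<le> \<sigma>" "\<sigma> \<le> 1" for \<sigma>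
    using convexD[of "{0<..<1::real}" s t "1 - \<sigma>" \<sigma>] that st by simp
  have u: "0 < u" "u < 1" using comb[OF \<theta>] by (auto simp: u_def)
  show "0 \<le> (1 - \<theta>) * s + \<theta> * t" "(1 - \<theta>) * s + \<theta> * t \<le> 1"
    using u by (auto simp: u_def)
  fix x :: "complex ^ 'n"
  define b where "b = A *v x"
  define a where "a j = cmod (x $ j) powr (1 / u)" for j
  define c where "c i = cmod (b $ i) powr (1 / u)" for i
  define X where "X = (\<Sum>j\<in>UNIV. a j)"
  define C where "C = (\<Sum>i\<in>UNIV. c i)"
  have nonneg: "0 \<le> a j" "0 \<le> c j" for j by (auto simp: a_def c_def)
  have normx: "lp_norm (exponent u) x = X powr u" and normb: "lp_norm (exponent u) b = C powr u"
    using u by (auto simp: lp_norm_exponent X_def C_def a_def c_def)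
  have "lp_norm (exponent u) b \<le> exp ((1 - \<theta>) * log_op_norm A s + \<theta> * log_op_norm A t) * lp_norm (exponent u) x"
  proof (cases "b = 0")
    case True
    then show ?thesis
      using lp_norm_nonneg[OF exponent_ge_1[of u], of x] u by simp
  next
    case False
    then have "x \<noteq> 0" by (auto simp: b_def)
    then have "0 < X powr u" "0 < C powr u"
      using False u lp_norm_pos[OF exponent_ge_1[of u]] by (metis normx normb less_imp_le)+
    moreover have "0 \<le> X" "0 \<le> C"
      unfolding X_def C_def by (auto intro!: sum_nonneg nonneg)
    ultimately have XC: "0 < X" "0 < C" by (auto simp: less_le)
    define \<alpha> where "\<alpha> z = (1 - z) * complex_of_real s + z * complex_of_real t" for z
    have Re\<alpha>: "Re (\<alpha> z) = (1 - Re z) * s + Re z * t" for z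
      by (simp add: \<alpha>_def)
    define v where "v z = (\<chi> j. sgn (x $ j) * complex_of_real (a j) powr \<alpha> z)" for z
    define w where "w z i = cnj (sgn (b $ i)) * complex_of_real (c i) powr (1 - \<alpha> z)" for z i
    define F where "F z = (\<Sum>i\<in>UNIV. w z i * ((A *v v z) $ i))" for z
    have holF: "F holomorphic_on S" for S
      unfolding F_def w_def v_def matrix_vector_mult_def \<alpha>_def vec_lambda_beta
      by (intro holomorphic_intros)
    have normv: "cmod (v z $ j) = a j powr Re (\<alpha> z)" for z j
      by (cases "x $ j = 0") (auto simp: v_def norm_mult norm_sgn norm_powr_real_powr a_def)
    have normw: "cmod (w z i) = c i powr (1 - Re (\<alpha> z))" for z i
      by (cases "b $ i = 0") (auto simp: w_def norm_mult norm_sgn norm_powr_real_powr c_def)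
    have F_le: "cmod (F z) \<le> exp (log_op_norm A r) * X powr r * C powr (1 - r)"
      if r: "Re (\<alpha> z) = r" "0 < r" "r < 1" for z r
    proof -
      have "cmod (F z) \<le> (\<Sum>i\<in>UNIV. (cmod ((A *v v z) $ i) powr (1 / r)) powr r * c i powr (1 - r))"
        unfolding F_def
        using r by (intro sum_norm_le) (auto simp: norm_mult normw powr_powr)
      also have "\<dots> \<le> (\<Sum>i\<in>UNIV. cmod ((A *v v z) $ i) powr (1 / r)) powr r * C powr (1 - r)"
        unfolding C_def using r by (intro Holder_sum) (auto intro: nonneg)
      also have "(\<Sum>i\<in>UNIV. cmod ((A *v v z) $ i) powr (1 / r)) powr r = lp_norm (exponent r) (A *v v z)"
        using r by (simp add: lp_norm_exponent)
      also have "\<dots> \<le> exp (log_op_norm A r) * lp_norm (exponent r) (v z)"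
        using r A by (intro lp_norm_le_exp_log_op_norm) auto
      also have "lp_norm (exponent r) (v z) = X powr r"
        using r by (simp add: lp_norm_exponent normv powr_powr X_def nonneg)
      finally show ?thesis by (simp add: mult_right_mono)
    qed
    have grow: "y powr r \<le> 1 + y" if "0 \<le> y" "0 \<le> r" "r \<le> 1" for y r :: real
      using that powr_mono[of r 1 y] powr_le1[of r y] by (cases "1 \<le> y") auto
    \<comment> \<open>The three lines theorem requires some bound on the whole strip; its size does not matter.\<close>
    define B where "B = (\<Sum>i\<in>UNIV. (1 + c i) * (\<Sum>j\<in>UNIV. cmod (A $ i $ j) * (1 + a j)))"
    have bound: "cmod (F z) \<le> B" if "0 \<le> Re z" "Re z \<le> 1" for z
    proof -
      have r: "0 < Re (\<alpha> z)" "Re (\<alpha> z) < 1" using comb[OF that] by (auto simp: Re\<alpha>)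
      have 1: "cmod ((A *v v z) $ i) \<le> (\<Sum>j\<in>UNIV. cmod (A $ i $ j) * (1 + a j))" for i
        unfolding matrix_vector_mult_def vec_lambda_beta
        using r by (intro sum_norm_le) (auto simp: norm_mult normv intro!: mult_left_mono grow nonneg)
      show ?thesis
        unfolding F_def B_def
      proof (rule sum_norm_le)
        fix i
        show "cmod (w z i * ((A *v v z) $ i)) \<le> (1 + c i) * (\<Sum>j\<in>UNIV. cmod (A $ i $ j) * (1 + a j))"
          unfolding norm_mult normw
          using r by (intro mult_mono 1 grow nonneg) (auto intro: nonneg add_nonneg_nonneg)
      qed
    qed
    have "F (complex_of_real \<theta>) = complex_of_real C"
    proof -
      have \<alpha>\<theta>: "\<alpha> (complex_of_real \<theta>) = complex_of_real u"
        by (simp add: \<alpha>_def u_def)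
      have "v (complex_of_real \<theta>) $ j = x $ j" for j
      proof -
        have "v (complex_of_real \<theta>) $ j = sgn (x $ j) * complex_of_real (a j powr u)"
          by (simp add: v_def \<alpha>\<theta> powr_of_real[OF nonneg(1)])
        also have "a j powr u = cmod (x $ j)"
          using u by (simp add: a_def powr_powr)
        finally show ?thesis by (simp add: sgn_eq)
      qed
      then have "v (complex_of_real \<theta>) = x" by (simp add: vec_eq_iff)
      moreover have "w (complex_of_real \<theta>) i * (b $ i) = complex_of_real (c i)" for i
      proof -
        have "w (complex_of_real \<theta>) i * (b $ i)
            = complex_of_real (c i powr (1 - u)) * (cnj (sgn (b $ i)) * (b $ i))"
          using powr_of_real[OF nonneg(2), of i "1 - u"] by (simp add: w_def \<alpha>\<theta>)
        also have "cnj (sgn (b $ i)) * (b $ i) = complex_of_real (cmod (b $ i))"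
          by (rule cnj_sgn_mult_self)
        also have "cmod (b $ i) = c i powr u"
          using u by (simp add: c_def powr_powr)
        also have "complex_of_real (c i powr (1 - u)) * complex_of_real (c i powr u) = complex_of_real (c i)"
          using nonneg(2)[of i] by (simp flip: of_real_mult powr_add)
        finally show ?thesis .
      qed
      ultimately show ?thesis
        by (simp add: F_def b_def[symmetric] C_def)
    qed
    moreover have "cmod (F (complex_of_real \<theta>)) \<le>
        (exp (log_op_norm A s) * X powr s * C powr (1 - s)) powr (1 - Re (complex_of_real \<theta>))
        * (exp (log_op_norm A t) * X powr t * C powr (1 - t)) powr Re (complex_of_real \<theta>)"
      by (rule Hadamard_three_lines[where B = B])
         (use XC \<theta> bound st in \<open>auto intro!: holF F_le holomorphic_on_imp_continuous_on simp: Re\<alpha>\<close>)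
    ultimately have "C \<le> (exp (log_op_norm A s) * X powr s * C powr (1 - s)) powr (1 - \<theta>)
        * (exp (log_op_norm A t) * X powr t * C powr (1 - t)) powr \<theta>"
      using XC by simp
    then have "ln C \<le> ln ((exp (log_op_norm A s) * X powr s * C powr (1 - s)) powr (1 - \<theta>)
        * (exp (log_op_norm A t) * X powr t * C powr (1 - t)) powr \<theta>)"
      using XC by simp
    also have "\<dots> = (1 - \<theta>) * log_op_norm A s + \<theta> * log_op_norm A t + u * ln X + (1 - u) * ln C"
      using XC by (simp add: ln_mult u_def algebra_simps)
    finally have "u * ln C \<le> (1 - \<theta>) * log_op_norm A s + \<theta> * log_op_norm A t + u * ln X"
      by (simp add: algebra_simps)
    then have "exp (u * ln C) \<le> exp ((1 - \<theta>) * log_op_norm A s + \<theta> * log_op_norm A t + u * ln X)"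
      by simp
    then show ?thesis
      using XC unfolding normx normb by (simp add: powr_def exp_add)
  qed
  then show "lp_norm (exponent ((1 - \<theta>) * s + \<theta> * t)) (A *v x)
    \<le> exp ((1 - \<theta>) * log_op_norm A s + \<theta> * log_op_norm A t) * lp_norm (exponent ((1 - \<theta>) * s + \<theta> * t)) x"
    by (simp only: b_def u_def)
qed (rule A)

theorem convex_on_log_op_norm:
  assumes "A \<noteq> 0"
  shows "convex_on {0..1} (log_op_norm A)"
proof -
  have "convex_on {0<..<1} (log_op_norm A)"
    by (rule convex_onI) (use Riesz_Thorin_interior[OF assms] in auto)
  then have "convex_on (closure {0<..<1}) (log_op_norm A)"
    by (rule convex_on_closure) (simp add: continuous_on_log_op_norm assms)
  then show ?thesis by simp
qed

section \<open>Transfer to the exponents\<close>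

lemma lp_op_norm_eq_exp_recip:
  assumes "A \<noteq> 0" "1 \<le> p"
  shows "lp_op_norm A p = exp (log_op_norm A (recip p))"
  using lp_op_norm_eq_exp[OF assms(1), of "recip p"] recip_bounds[OF assms(2)] exponent_recip[OF assms(2)]
  by simp

theorem proposition3p2:
  fixes A :: "complex ^ 'n ^ 'n"
  shows
    "continuous_on {1..\<infinity>} (lp_op_norm A)
     \<and>
     (\<exists>p0\<in>{1..\<infinity>}.
        antimono_on {1..p0} (lp_op_norm A) \<and>
        mono_on {p0..\<infinity>} (lp_op_norm A) \<and>
        (\<forall>p\<in>{1..<p0}. lp_op_norm A p > lp_op_norm A p0 \<longrightarrow>
           (\<forall>q\<in>{p<..<p0}. lp_op_norm A p > lp_op_norm A q)) \<and>
        (\<forall>p\<in>{p0<..\<infinity>}. lp_op_norm A p > lp_op_norm A p0 \<longrightarrow>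
           (\<forall>q\<in>{p0<..<p}. lp_op_norm A p > lp_op_norm A q)))
     \<and>
     (\<forall>p q0 r. 1 \<le> p \<and> p < q0 \<and> q0 < r \<and> r \<le> \<infinity> \<longrightarrow>
        (rpow (lp_op_norm A q0) (recip p - recip r) =
           rpow (lp_op_norm A p) (recip q0 - recip r) * rpow (lp_op_norm A r) (recip p - recip q0) \<longrightarrow>
         (\<forall>q\<in>{p..r}.
            rpow (lp_op_norm A q) (recip p - recip r) =
              rpow (lp_op_norm A p) (recip q - recip r) * rpow (lp_op_norm A r) (recip p - recip q))) \<and>
        (lp_op_norm A p = lp_op_norm A q0 \<and> lp_op_norm A q0 = lp_op_norm A r \<longrightarrow>
         (\<forall>q\<in>{p..r}. lp_op_norm A p = lp_op_norm A q)))"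
proof (cases "A = 0")
  case True
  have z: "lp_op_norm A p = 0" if "1 \<le> p" for p
    unfolding True using that by (rule lp_op_norm_zero)
  have continuous: "continuous_on {1..\<infinity>} (lp_op_norm A)"
    using z by (subst continuous_on_cong[OF refl, of _ _ "\<lambda>_. 0"]) auto
  have monotone: "antimono_on {1..1} (lp_op_norm A)" "mono_on {1..\<infinity>} (lp_op_norm A)"
    using z by (auto intro!: monotone_onI)
  have equality_trivial: "rpow (lp_op_norm A q) (recip p - recip r) =
      rpow (lp_op_norm A p) (recip q - recip r) * rpow (lp_op_norm A r) (recip p - recip q)"
    if "1 \<le> p" "p < r" "q \<in> {p..r}" for p q r
  proof -
    have "1 \<le> q" "1 \<le> r" using that by auto
    then show ?thesis
      using that(1) z[of p] z[of q] z[of r] recip_less[OF that(1,2)] by (simp add: rpow_def)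
  qed
  have one_in: "1 \<in> {1..\<infinity>::ereal}" by simp
  have strict_left: "\<forall>p\<in>{1..<1}. lp_op_norm A p > lp_op_norm A 1 \<longrightarrow>
          (\<forall>q\<in>{p<..<1}. lp_op_norm A p > lp_op_norm A q)"
    by simp
  have strict_right: "\<forall>p\<in>{1<..\<infinity>}. lp_op_norm A p > lp_op_norm A 1 \<longrightarrow>
          (\<forall>q\<in>{1<..<p}. lp_op_norm A p > lp_op_norm A q)"
    using z by auto
  show ?thesis
  proof (intro conjI bexI[of _ 1] continuous monotone one_in strict_left strict_right,
      (intro allI impI conjI ballI; elim conjE))
    fix p q0 r q :: ereal
    assume 1: "1 \<le> p" "p < q0" "q0 < r" "q \<in> {p..r}"
    show "rpow (lp_op_norm A q) (recip p - recip r) =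
        rpow (lp_op_norm A p) (recip q - recip r) * rpow (lp_op_norm A r) (recip p - recip q)"
      by (rule equality_trivial[OF 1(1) less_trans[OF 1(2,3)] 1(4)])
    have "1 \<le> q" using 1 by auto
    then show "lp_op_norm A p = lp_op_norm A q" using z 1(1) by simp
  qed
next
  case False
  define h where "h = log_op_norm A"
  have f: "lp_op_norm A p = exp (h (recip p))" if "1 \<le> p" for p
    unfolding h_def by (rule lp_op_norm_eq_exp_recip[OF False that])
  have h: "convex_on {0..1} h" "continuous_on {0..1} h"
    unfolding h_def by (fact convex_on_log_op_norm[OF False] continuous_on_log_op_norm[OF False])+
  have recip_in: "recip p \<in> {0..1}" if "1 \<le> p" for p
    using recip_bounds[OF that] by simp

  have "continuous_on {1..\<infinity>} (\<lambda>p. exp (h (recip p)))"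
    by (intro continuous_on_exp continuous_on_compose2[OF h(2)] continuous_on_recip) (use recip_in in auto)
  then have continuous: "continuous_on {1..\<infinity>} (lp_op_norm A)"
    using f by (subst continuous_on_cong[OF refl, of _ _ "\<lambda>p. exp (h (recip p))"]) auto

  obtain t0 where t0: "t0 \<in> {0..1}" "\<And>t. t \<in> {0..1} \<Longrightarrow> h t0 \<le> h t"
    using continuous_attains_inf[OF _ _ h(2)] by auto
  define p0 where "p0 = exponent t0"
  have p0: "1 \<le> p0" "recip p0 = t0"
    using t0 by (auto simp: p0_def exponent_ge_1 recip_exponent)
  have mono: "lp_op_norm A q \<le> lp_op_norm A p" if "1 \<le> p" "p \<le> q \<and> q \<le> p0 \<or> p0 \<le> q \<and> q \<le> p" for p q
  proof -
    have q: "1 \<le> q" using that p0 by auto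
    have "h (recip q) \<le> h (recip p)"
    proof (cases "q = p \<or> q = p0")
      case True
      then show ?thesis using t0(2) recip_in that p0 by auto
    next
      case False
      then have "p < q \<and> q < p0 \<or> p0 < q \<and> q < p" using that by auto
      then show ?thesis
        using convex_on_between(1)[OF h(1) t0(1) recip_in, of p "recip q"] t0(2) recip_in that(1) q p0
          recip_less[of p q] recip_less[of q p] recip_less[of p0 q] recip_less[of q p0]
        by auto
    qed
    then show ?thesis using f that q by simp
  qed
  have strict: "lp_op_norm A q < lp_op_norm A p"
    if "1 \<le> p" "lp_op_norm A p0 < lp_op_norm A p" "p < q \<and> q < p0 \<or> p0 < q \<and> q < p" for p q
  proof -
    have q: "1 \<le> q" using that p0 by auto
    have "h (recip q) < h (recip p)"
      using convex_on_between(2)[OF h(1) t0(1) recip_in, of p "recip q"] that q p0 f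
        recip_less[of p q] recip_less[of q p] recip_less[of p0 q] recip_less[of q p0]
      by auto
    then show ?thesis using f that q by simp
  qed
  have p0_props: "p0 \<in> {1..\<infinity>}" "antimono_on {1..p0} (lp_op_norm A)" "mono_on {p0..\<infinity>} (lp_op_norm A)"
    using p0 mono by (auto intro!: monotone_onI)

  \<comment> \<open>All norms are positive, so both sides are exponentials and only the exponents need to be compared.\<close>
  have log_eq_iff: "rpow (lp_op_norm A q) (recip p - recip r) =
             rpow (lp_op_norm A p) (recip q - recip r) * rpow (lp_op_norm A r) (recip p - recip q)
       \<longleftrightarrow> (recip p - recip r) * h (recip q)
             = (recip p - recip q) * h (recip r) + (recip q - recip r) * h (recip p)"
    if "1 \<le> p" "1 \<le> q" "1 \<le> r" for p q r
  proof -
    have rpow: "rpow (lp_op_norm A s) e = exp (e * h (recip s))" if "1 \<le> s" for s e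
      using that by (simp add: rpow_def f powr_def)
    show ?thesis
      using that by (simp add: rpow add.commute flip: exp_add)
  qed
  have chord: "(recip p - recip r) * h (recip q) = (recip p - recip q) * h (recip r) + (recip q - recip r) * h (recip p)"
    if "1 \<le> p" "p < q0" "q0 < r" "q \<in> {p..r}"
      "(recip p - recip r) * h (recip q0) = (recip p - recip q0) * h (recip r) + (recip q0 - recip r) * h (recip p)"
    for p q0 r q
  proof (rule convex_on_affine_if_touching[OF h(1) _ _ _ _ that(5)])
    show "recip r \<in> {0..1}" "recip p \<in> {0..1}" using that by (intro recip_in; auto)+
    show "recip r < recip q0" "recip q0 < recip p" using that by (auto intro!: recip_less)
    show "recip r \<le> recip q" "recip q \<le> recip p" using that by (auto intro!: recip_le)
  qed
  have equality_everywhere: "rpow (lp_op_norm A q) (recip p - recip r) =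
             rpow (lp_op_norm A p) (recip q - recip r) * rpow (lp_op_norm A r) (recip p - recip q)"
    if pqr: "1 \<le> p" "p < q0" "q0 < r" "q \<in> {p..r}"
      and eq: "rpow (lp_op_norm A q0) (recip p - recip r) =
        rpow (lp_op_norm A p) (recip q0 - recip r) * rpow (lp_op_norm A r) (recip p - recip q0)"
    for p q0 r q
  proof -
    have ge: "1 \<le> q0" "1 \<le> q" "1 \<le> r" using pqr by auto
    show ?thesis
      using chord[OF pqr] log_eq_iff[of p q0 r] log_eq_iff[of p q r] eq pqr ge by blast
  qed
  have constant_between: "lp_op_norm A p = lp_op_norm A q"
    if pqr: "1 \<le> p" "p < q0" "q0 < r" "q \<in> {p..r}"
      and eq: "lp_op_norm A p = lp_op_norm A q0" "lp_op_norm A q0 = lp_op_norm A r"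
    for p q0 r q
  proof -
    have ge: "1 \<le> q0" "1 \<le> q" "1 \<le> r" using pqr by auto
    then have hh: "h (recip q0) = h (recip p)" "h (recip r) = h (recip p)"
      using eq f pqr by auto
    have "(recip p - recip r) * h (recip q) = (recip p - recip r) * h (recip p)"
      using chord[OF pqr] hh by (simp add: algebra_simps)
    moreover have "recip p \<noteq> recip r" using recip_less[of p r] pqr(1) less_trans[OF pqr(2,3)] by simp
    ultimately show ?thesis using f pqr ge by simp
  qed
  have strict_left: "\<forall>p\<in>{1..<p0}. lp_op_norm A p > lp_op_norm A p0 \<longrightarrow>
          (\<forall>q\<in>{p<..<p0}. lp_op_norm A p > lp_op_norm A q)"
    using strict by auto
  have strict_right: "\<forall>p\<in>{p0<..\<infinity>}. lp_op_norm A p > lp_op_norm A p0 \<longrightarrow>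
          (\<forall>q\<in>{p0<..<p}. lp_op_norm A p > lp_op_norm A q)"
  proof (intro ballI impI)
    fix p q assume "p \<in> {p0<..\<infinity>}" "lp_op_norm A p0 < lp_op_norm A p" "q \<in> {p0<..<p}"
    moreover from this have "1 \<le> p" using p0(1) by auto
    ultimately show "lp_op_norm A q < lp_op_norm A p" using strict[of p q] by auto
  qed
  show ?thesis
  proof (intro conjI bexI[of _ p0] continuous p0_props strict_left strict_right,
      (intro allI impI conjI ballI; elim conjE))
    fix p q0 r q :: ereal
    assume 1: "1 \<le> p" "p < q0" "q0 < r" "q \<in> {p..r}"
    show "rpow (lp_op_norm A q) (recip p - recip r) =
        rpow (lp_op_norm A p) (recip q - recip r) * rpow (lp_op_norm A r) (recip p - recip q)"
      if "rpow (lp_op_norm A q0) (recip p - recip r) =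
        rpow (lp_op_norm A p) (recip q0 - recip r) * rpow (lp_op_norm A r) (recip p - recip q0)"
      by (rule equality_everywhere[OF 1 that])
    show "lp_op_norm A p = lp_op_norm A q"
      if "lp_op_norm A p = lp_op_norm A q0" "lp_op_norm A q0 = lp_op_norm A r"
      by (rule constant_between[OF 1 that])
  qed
qed

end
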